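(* Let $\pi\in(0,1)$. There exists a constant $C>0$ that depends only on $\pi$ such that, for every $n\ge 1$, all potential outcome functions $y_i:\{0,1\}^n\to\mathbb{R}$ and all exposure mappings $d_i:\{0,1\}^n\to\mathcal{D}_i$ ($i\in[n]$), $$\max_{\star\in\{\mathrm{MPE},\mathrm{ADE},\mathrm{AIE}\}}\big|\tau_\star(\pi)-\tau_\star^{\mathrm{oracle}}(\pi)\big|\le C\Big\{\sum_{i\in[n]}\mathbb{E}_{\mathbf{W}}\big[\mathrm{Var}(y_i(\mathbf{W})\mid d_i(\mathbf{W}))\big]\Big\}^{1/2},$$ where $\mathbf{W}\sim\mathrm{RCT}(\pi)$. In particular, along a sequence of such models with $n\to\infty$, if $\sum_{i\in[n]}\mathbb{E}_{\mathbf{W}}[\mathrm{Var}(y_i(\mathbf{W})\mid d_i(\mathbf{W}))]=o(1)$, then $\max_{\star}|\tau_\star(\pi)-\tau_\star^{\mathrm{oracle}}(\pi)|\to0$.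
   Context: Units are indexed by $[n]=\{1,\dots,n\}$. $\mathbf{W}=(W_1,\dots,W_n)\sim\mathrm{RCT}(\pi)$ means that the $W_i$ are independent with $\mathbb{P}(W_i=1)=1-\mathbb{P}(W_i=0)=\pi$. The outcome functions are held fixed; expectations and variances are over $\mathbf{W}$. $f(w_i=t,\mathbf{W}_{-i})$ is the value of $f$ at the vector whose $i$-th coordinate is $t$ and whose other coordinates are those of $\mathbf{W}$. Oracle effects: $$\tau_{\mathrm{ADE}}^{\mathrm{oracle}}(\pi)=\frac1n\sum_{i=1}^n\mathbb{E}[y_i(w_i=1,\mathbf{W}_{-i})-y_i(w_i=0,\mathbf{W}_{-i})],$$ $$\tau_{\mathrm{AIE}}^{\mathrm{oracle}}(\pi)=\frac1n\sum_{j=1}^n\sum_{i\ne j}\mathbb{E}[y_j(w_i=1,\mathbf{W}_{-i})-y_j(w_i=0,\mathbf{W}_{-i})],$$ $\tau_{\mathrm{MPE}}^{\mathrm{oracle}}(\pi)=\tau_{\mathrm{ADE}}^{\mathrm{oracle}}(\pi)+\tau_{\mathrm{AIE}}^{\mathrm{oracle}}(\pi)$. Pseudo-true outcome model: $h_i^*(d;\pi)=\mathbb{E}_{\mathbf{W}\sim\mathrm{RCT}(\pi)}[y_i(\mathbf{W})\mid d_i(\mathbf{W})=d]$ for $d$ in the range of $d_i$, and $\tilde y_i(\mathbf{w};\pi)=h_i^*(d_i(\mathbf{w});\pi)$. Pseudo-true effects: $\tau_{\mathrm{ADE}}(\pi)$ and $\tau_{\mathrm{AIE}}(\pi)$ are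 given by the two oracle formulas above with each $y_i(\cdot)$ replaced by $\tilde y_i(\cdot;\pi)$; and $$\mu(\pi_1,\pi_2)=\frac1n\sum_{i=1}^n\mathbb{E}_{\mathbf{W}^{(1)}\sim\mathrm{RCT}(\pi_1)}\big[h_i^*(d_i(\mathbf{W}^{(1)});\pi_2)\big],\qquad \tau_{\mathrm{MPE}}(\pi)=\frac{\partial}{\partial\pi_1}\mu(\pi_1,\pi_2)\Big|_{\pi_1=\pi_2=\pi}.$$ *)

theory Defs
  imports "HOL-Probability.Probability" "HOL-Library.Landau_Symbols"
begin

(* A treatment vector in {0,1}^n is a function w :: nat => bool that is False outside {1..n};
   w i = True encodes w_i = 1.  The support of RCT n p (0 < p < 1) is exactly this set of vectors,
   and w(i := t) stays in it for i in {1..n}; so the values of outcomes and exposures at other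
   functions nat => bool never matter. *)
definition RCT :: "nat \<Rightarrow> real \<Rightarrow> (nat \<Rightarrow> bool) pmf" where
  "RCT n \<pi> = Pi_pmf {1..n} False (\<lambda>_. bernoulli_pmf \<pi>)"

type_synonym outcomes = "nat \<Rightarrow> (nat \<Rightarrow> bool) \<Rightarrow> real"

(* Unit i has the exposure mapping d i.  The sets D_i may all differ; they are regarded as subsets
   of a single type 'd. *)
type_synonym 'd exposures = "nat \<Rightarrow> (nat \<Rightarrow> bool) \<Rightarrow> 'd"

definition oracle_ADE :: "nat \<Rightarrow> real \<Rightarrow> outcomes \<Rightarrow> real" where
  "oracle_ADE n \<pi> y =
     1 / real n * (\<Sum>i=1..n.
       measure_pmf.expectation (RCT n \<pi>) (\<lambda>w. y i (w(i := True)) - y i (w(i := False))))"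

definition oracle_AIE :: "nat \<Rightarrow> real \<Rightarrow> outcomes \<Rightarrow> real" where
  "oracle_AIE n \<pi> y =
     1 / real n * (\<Sum>j=1..n. \<Sum>i\<in>{1..n} - {j}.
       measure_pmf.expectation (RCT n \<pi>) (\<lambda>w. y j (w(i := True)) - y j (w(i := False))))"

definition oracle_MPE :: "nat \<Rightarrow> real \<Rightarrow> outcomes \<Rightarrow> real" where
  "oracle_MPE n \<pi> y = oracle_ADE n \<pi> y + oracle_AIE n \<pi> y"

(* The law of W given d_i(W) = x.  cond_pmf is only meaningful when the event has positive
   probability, i.e. (for 0 < p < 1) when x is in the range of d_i on {0,1}^n. *)
definition RCT_given ::
  "nat \<Rightarrow> real \<Rightarrow> ((nat \<Rightarrow> bool) \<Rightarrow> 'd) \<Rightarrow> 'd \<Rightarrow> (nat \<Rightarrow> bool) pmf" where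
  "RCT_given n \<pi> di x = cond_pmf (RCT n \<pi>) {w. di w = x}"

definition hstar :: "nat \<Rightarrow> outcomes \<Rightarrow> 'd exposures \<Rightarrow> nat \<Rightarrow> 'd \<Rightarrow> real \<Rightarrow> real" where
  "hstar n y d i x \<pi> = measure_pmf.expectation (RCT_given n \<pi> (d i) x) (y i)"

definition pseudo_outcome :: "nat \<Rightarrow> real \<Rightarrow> outcomes \<Rightarrow> 'd exposures \<Rightarrow> outcomes" where
  "pseudo_outcome n \<pi> y d = (\<lambda>i w. hstar n y d i (d i w) \<pi>)"

definition pseudo_ADE :: "nat \<Rightarrow> real \<Rightarrow> outcomes \<Rightarrow> 'd exposures \<Rightarrow> real" where
  "pseudo_ADE n \<pi> y d = oracle_ADE n \<pi> (pseudo_outcome n \<pi> y d)"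

definition pseudo_AIE :: "nat \<Rightarrow> real \<Rightarrow> outcomes \<Rightarrow> 'd exposures \<Rightarrow> real" where
  "pseudo_AIE n \<pi> y d = oracle_AIE n \<pi> (pseudo_outcome n \<pi> y d)"

definition policy_mean :: "nat \<Rightarrow> outcomes \<Rightarrow> 'd exposures \<Rightarrow> real \<Rightarrow> real \<Rightarrow> real" where
  "policy_mean n y d \<pi>1 \<pi>2 =
     1 / real n * (\<Sum>i=1..n.
       measure_pmf.expectation (RCT n \<pi>1) (\<lambda>w. hstar n y d i (d i w) \<pi>2))"

definition pseudo_MPE :: "nat \<Rightarrow> real \<Rightarrow> outcomes \<Rightarrow> 'd exposures \<Rightarrow> real" where
  "pseudo_MPE n \<pi> y d = deriv (\<lambda>\<pi>1. policy_mean n y d \<pi>1 \<pi>) \<pi>"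

definition max_bias :: "nat \<Rightarrow> real \<Rightarrow> outcomes \<Rightarrow> 'd exposures \<Rightarrow> real" where
  "max_bias n \<pi> y d =
     Max {\<bar>pseudo_MPE n \<pi> y d - oracle_MPE n \<pi> y\<bar>,
          \<bar>pseudo_ADE n \<pi> y d - oracle_ADE n \<pi> y\<bar>,
          \<bar>pseudo_AIE n \<pi> y d - oracle_AIE n \<pi> y\<bar>}"

definition cond_variance :: "nat \<Rightarrow> real \<Rightarrow> outcomes \<Rightarrow> 'd exposures \<Rightarrow> nat \<Rightarrow> 'd \<Rightarrow> real" where
  "cond_variance n \<pi> y d i x = measure_pmf.variance (RCT_given n \<pi> (d i) x) (y i)"

definition total_cond_variance :: "nat \<Rightarrow> real \<Rightarrow> outcomes \<Rightarrow> 'd exposures \<Rightarrow> real" where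
  "total_cond_variance n \<pi> y d =
     (\<Sum>i=1..n. measure_pmf.expectation (RCT n \<pi>) (\<lambda>w. cond_variance n \<pi> y d i (d i w)))"

(* C bounds the bias for all n, all outcomes and all exposure mappings with values in 'd.
   HOL cannot say "there is C such that for all types 'd".  That C does not depend on the exposure
   sets is instead expressed by taking it from the single type nat, and requiring that every such C
   also bounds the bias for an arbitrary type 'd. *)
definition bias_bound :: "'d itself \<Rightarrow> real \<Rightarrow> real \<Rightarrow> bool" where
  "bias_bound (_ :: 'd itself) \<pi> C \<longleftrightarrow>
     (\<forall>n\<ge>1. \<forall>y. \<forall>d :: 'd exposures. max_bias n \<pi> y d \<le> C * sqrt (total_cond_variance n \<pi> y d))"

end

theory Submission
  imports Defs
begin

text \<open>
  Let \<open>S\<^sub>j = (W\<^sub>j - \<pi>) / (\<pi> (1 - \<pi>))\<close> be the score of the \<open>j\<close>-th coordinate. Then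
  \<open>E[f(w\<^sub>j = 1) - f(w\<^sub>j = 0)] = E[f S\<^sub>j]\<close>, and the derivative of \<open>E\<^sub>\<pi> f\<close> in \<open>\<pi>\<close> is
  \<open>E[f \<Sum>\<^sub>j S\<^sub>j]\<close>. Hence each of the three biases is an average over \<open>i\<close> of
  \<open>E[e\<^sub>i \<Sum>\<^sub>j S\<^sub>j]\<close> with \<open>j\<close> in a set depending on \<open>i\<close>, where \<open>e\<^sub>i\<close> is the difference between the
  pseudo-true and the true outcome. The scores are orthogonal with second moment
  \<open>1 / (\<pi> (1 - \<pi>))\<close> and \<open>E[e\<^sub>i\<^sup>2] = E[Var(y\<^sub>i | d\<^sub>i)]\<close>, so Cauchy-Schwarz
  gives the bound with \<open>C = 1 / sqrt (\<pi> (1 - \<pi>))\<close>.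
\<close>

section \<open>Treatment vectors and expectations as finite sums\<close>

definition treatments :: "nat \<Rightarrow> (nat \<Rightarrow> bool) set" where
  "treatments n = PiE_dflt {1..n} False (\<lambda>_. UNIV)"

definition score :: "real \<Rightarrow> nat \<Rightarrow> (nat \<Rightarrow> bool) \<Rightarrow> real" where
  "score p j w = (of_bool (w j) - p) / (p * (1 - p))"

text \<open>Common shape of the three effects: \<open>A i\<close> holds the coordinates whose scores
  are paired with the outcome of unit i, so one estimate, uniform in \<open>A\<close>, covers them
  all.\<close>

definition score_mean :: "nat \<Rightarrow> real \<Rightarrow> (nat \<Rightarrow> nat set) \<Rightarrow> outcomes \<Rightarrow> real" where
  "score_mean n p A y = 1 / real n * (\<Sum>i=1..n.
     measure_pmf.expectation (RCT n p) (\<lambda>w. y i w * (\<Sum>j\<in>A i. score p j w)))"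

lemma finite_treatments [simp]: "finite (treatments n)"
  unfolding treatments_def by (rule finite_PiE_dflt) auto

text \<open>An inclusion is all that finite sums require, and it holds for every real
  \<open>p\<close>.\<close>

lemma set_RCT_subset: "set_pmf (RCT n p) \<subseteq> treatments n"
  unfolding RCT_def treatments_def
  using set_Pi_pmf_subset'[of "{1..n}" False "\<lambda>_. bernoulli_pmf p"]
  by (auto simp: PiE_dflt_def)

lemma set_RCT: "0 < p \<Longrightarrow> p < 1 \<Longrightarrow> set_pmf (RCT n p) = treatments n"
  unfolding RCT_def treatments_def by (subst set_Pi_pmf) (auto simp: comp_def)

lemma expectation_RCT:
  "measure_pmf.expectation (RCT n p) f = (\<Sum>w\<in>treatments n. pmf (RCT n p) w * f w)"
  for f :: "(nat \<Rightarrow> bool) \<Rightarrow> real"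
  using integral_measure_pmf[of "treatments n" "RCT n p" f] set_RCT_subset[of n p] by auto

lemma integrable_RCT [simp]: "integrable (measure_pmf (RCT n p)) f"
  for f :: "(nat \<Rightarrow> bool) \<Rightarrow> real"
  by (rule integrable_measure_pmf_finite) (meson finite_subset finite_treatments set_RCT_subset)

lemma expectation_RCT_cong:
  fixes f g :: "(nat \<Rightarrow> bool) \<Rightarrow> real"
  assumes "\<And>w. w \<in> treatments n \<Longrightarrow> f w = g w"
  shows "measure_pmf.expectation (RCT n p) f = measure_pmf.expectation (RCT n p) g"
  using assms unfolding expectation_RCT by (intro sum.cong) auto

lemma pmf_RCT:
  assumes "0 \<le> p" "p \<le> 1" "w \<in> treatments n"
  shows "pmf (RCT n p) w = (\<Prod>j=1..n. if w j then p else 1 - p)"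
proof -
  have "pmf (RCT n p) w = (\<Prod>j=1..n. pmf (bernoulli_pmf p) (w j))"
    unfolding RCT_def by (rule pmf_Pi') (use assms in \<open>auto simp: treatments_def PiE_dflt_def\<close>)
  also have "\<dots> = (\<Prod>j=1..n. if w j then p else 1 - p)"
    using assms by (intro prod.cong) auto
  finally show ?thesis .
qed

text \<open>By independence, coordinate i can be averaged separately from the others.\<close>

lemma expectation_RCT_split:
  fixes g :: "(nat \<Rightarrow> bool) \<Rightarrow> real"
  assumes "0 \<le> p" "p \<le> 1" "i \<in> {1..n}"
  shows "measure_pmf.expectation (RCT n p) g =
    measure_pmf.expectation (RCT n p) (\<lambda>w. p * g (w(i := True)) + (1 - p) * g (w(i := False)))"
proof -
  define Q where "Q = Pi_pmf ({1..n} - {i}) False (\<lambda>_. bernoulli_pmf p)"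
  have fin: "finite (set_pmf Q)"
    unfolding Q_def by (rule finite_subset[OF set_Pi_pmf_subset']) (auto intro: finite_PiE_dflt)
  have "insert i ({1..n} - {i}) = {1..n}"
    using assms by auto
  then have R: "RCT n p = bernoulli_pmf p \<bind> (\<lambda>b. map_pmf (\<lambda>w. w(i := b)) Q)"
    unfolding RCT_def using Pi_pmf_insert'[of "{1..n} - {i}" i False "\<lambda>_. bernoulli_pmf p"]
    by (simp add: map_pmf_def Q_def)
  \<comment> \<open>Used on both sides of the goal: the integrand on the right ignores
    \<open>w i\<close>, so there the weights \<open>p\<close> and \<open>1 - p\<close> just add up
    to 1.\<close>
  have split: "measure_pmf.expectation (RCT n p) f =
      p * measure_pmf.expectation Q (\<lambda>w. f (w(i := True)))
      + (1 - p) * measure_pmf.expectation Q (\<lambda>w. f (w(i := False)))"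
    for f :: "(nat \<Rightarrow> bool) \<Rightarrow> real"
    unfolding R using assms fin
    by (subst pmf_expectation_bind[of UNIV]) (auto simp: UNIV_bool)
  have [simp]: "integrable (measure_pmf Q) f" for f :: "(nat \<Rightarrow> bool) \<Rightarrow> real"
    by (rule integrable_measure_pmf_finite[OF fin])
  show ?thesis
    unfolding split by (simp add: algebra_simps)
qed

section \<open>Scores: differences, orthogonality, derivative in the treatment probability\<close>

lemma expectation_score:
  fixes f :: "(nat \<Rightarrow> bool) \<Rightarrow> real"
  assumes "0 < p" "p < 1" "i \<in> {1..n}"
  shows "measure_pmf.expectation (RCT n p) (\<lambda>w. f w * score p i w) =
    measure_pmf.expectation (RCT n p) (\<lambda>w. f (w(i := True)) - f (w(i := False)))"
proof -
  \<comment> \<open>The two values of the score are the reciprocals of the two probabilities, with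
    opposite signs, so the weights cancel.\<close>
  have "p * (f (w(i := True)) * score p i (w(i := True)))
      + (1 - p) * (f (w(i := False)) * score p i (w(i := False)))
      = f (w(i := True)) - f (w(i := False))" for w
  proof -
    have "score p i (w(i := True)) = 1 / p" "score p i (w(i := False)) = - 1 / (1 - p)"
      using assms by (auto simp: score_def divide_simps)
    then show ?thesis
      using assms by simp
  qed
  then show ?thesis
    using assms by (subst expectation_RCT_split[where i = i]) auto
qed

text \<open>Take \<open>score p j\<close> as the function in \<open>expectation_score\<close>: its
  increment in coordinate i vanishes unless j = i.\<close>

lemma expectation_score_score:
  assumes "0 < p" "p < 1" "i \<in> {1..n}"
  shows "measure_pmf.expectation (RCT n p) (\<lambda>w. score p j w * score p i w) =
    (if j = i then 1 / (p * (1 - p)) else 0)"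
  using assms by (subst expectation_score) (auto simp: score_def simp flip: diff_divide_distrib)

lemma expectation_sum_scores_squared:
  assumes p: "0 < p" "p < 1" and A: "A \<subseteq> {1..n}"
  shows "measure_pmf.expectation (RCT n p) (\<lambda>w. (\<Sum>j\<in>A. score p j w)\<^sup>2) = card A / (p * (1 - p))"
proof -
  have [simp]: "finite A"
    using A finite_subset by blast
  have "measure_pmf.expectation (RCT n p) (\<lambda>w. (\<Sum>j\<in>A. score p j w)\<^sup>2) =
      (\<Sum>j\<in>A. \<Sum>i\<in>A. measure_pmf.expectation (RCT n p) (\<lambda>w. score p j w * score p i w))"
    by (simp add: power2_eq_square sum_product)
  also have "\<dots> = (\<Sum>j\<in>A. \<Sum>i\<in>A. if j = i then 1 / (p * (1 - p)) else 0)"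
    using p A by (intro sum.cong refl expectation_score_score) auto
  finally show ?thesis
    by simp
qed

text \<open>The sum of all scores is the derivative in \<open>p\<close> of the logarithm of the
  probability of \<open>w\<close>.\<close>

lemma deriv_expectation_RCT:
  fixes f :: "(nat \<Rightarrow> bool) \<Rightarrow> real"
  assumes p: "0 < p" "p < 1"
  shows "((\<lambda>q. measure_pmf.expectation (RCT n q) f) has_real_derivative
    measure_pmf.expectation (RCT n p) (\<lambda>w. f w * (\<Sum>j=1..n. score p j w))) (at p)"
proof -
  let ?g = "\<lambda>w q. \<Prod>j=1..n. if w j then q else 1 - q :: real"
  have g: "(?g w has_real_derivative ?g w p * (\<Sum>j=1..n. score p j w)) (at p)" for w
  proof -
    \<comment> \<open>The numerator is the derivative of the j-th factor: 1 for \<open>q\<close>, -1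
      for \<open>1 - q\<close>.\<close>
    have s: "score p j w = (of_bool (w j) * 2 - 1) / (if w j then p else 1 - p)" for j
      using p by (auto simp: score_def divide_simps)
    have "(?g w has_real_derivative
        ?g w p * (\<Sum>j=1..n. (of_bool (w j) * 2 - 1) / (if w j then p else 1 - p))) (at p)"
      by (rule has_field_derivative_prod') (use p in \<open>auto intro!: derivative_eq_intros\<close>)
    then show ?thesis
      unfolding s .
  qed
  have "((\<lambda>q. \<Sum>w\<in>treatments n. ?g w q * f w) has_real_derivative
      (\<Sum>w\<in>treatments n. ?g w p * (\<Sum>j=1..n. score p j w) * f w)) (at p)"
    by (intro DERIV_sum DERIV_cmult_right g)
  moreover have "(\<Sum>w\<in>treatments n. ?g w p * (\<Sum>j=1..n. score p j w) * f w) =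
      measure_pmf.expectation (RCT n p) (\<lambda>w. f w * (\<Sum>j=1..n. score p j w))"
    unfolding expectation_RCT using p by (intro sum.cong) (auto simp: pmf_RCT)
  \<comment> \<open>The product formula is tied to genuine probabilities; agreement on an open
    interval around \<open>p\<close> is enough for the derivative.\<close>
  moreover have "measure_pmf.expectation (RCT n q) f = (\<Sum>w\<in>treatments n. ?g w q * f w)"
    if "q \<in> {0<..<1}" for q
    unfolding expectation_RCT using that by (intro sum.cong) (auto simp: pmf_RCT)
  ultimately show ?thesis
    using p by (auto intro: has_field_derivative_transform_within_open[where S = "{0<..<1}"])
qed

section \<open>The effects as score means\<close>

lemma oracle_ADE_eq:
  assumes "0 < p" "p < 1"
  shows "oracle_ADE n p y = score_mean n p (\<lambda>i. {i}) y"
  unfolding oracle_ADE_def score_mean_def using assms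
  by (intro arg_cong2[where f = "(*)"] sum.cong) (auto simp: expectation_score)

lemma oracle_AIE_eq:
  assumes "0 < p" "p < 1"
  shows "oracle_AIE n p y = score_mean n p (\<lambda>i. {1..n} - {i}) y"
  unfolding oracle_AIE_def score_mean_def using assms
  by (intro arg_cong2[where f = "(*)"] sum.cong) (auto simp: expectation_score sum_distrib_left)

lemma oracle_MPE_eq:
  assumes "0 < p" "p < 1"
  shows "oracle_MPE n p y = score_mean n p (\<lambda>_. {1..n}) y"
proof -
  have "score_mean n p (\<lambda>i. {i}) y + score_mean n p (\<lambda>i. {1..n} - {i}) y =
      1 / real n * (\<Sum>i=1..n. measure_pmf.expectation (RCT n p)
        (\<lambda>w. y i w * ((\<Sum>j\<in>{i}. score p j w) + (\<Sum>j\<in>{1..n} - {i}. score p j w))))"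
    unfolding score_mean_def by (simp add: distrib_left sum.distrib)
  also have "\<dots> = score_mean n p (\<lambda>_. {1..n}) y"
    unfolding score_mean_def
    by (intro arg_cong2[where f = "(*)"] sum.cong refl) (simp add: sum.remove)
  finally show ?thesis
    using assms by (simp add: oracle_MPE_def oracle_ADE_eq oracle_AIE_eq)
qed

text \<open>The second argument of \<open>policy_mean\<close> is frozen at \<open>p\<close>, so only
  the law of the treatments is differentiated.\<close>

lemma pseudo_MPE_eq:
  assumes "0 < p" "p < 1"
  shows "pseudo_MPE n p y d = score_mean n p (\<lambda>_. {1..n}) (pseudo_outcome n p y d)"
proof -
  have "((\<lambda>q. policy_mean n y d q p) has_real_derivative
      score_mean n p (\<lambda>_. {1..n}) (pseudo_outcome n p y d)) (at p)"
    unfolding policy_mean_def score_mean_def pseudo_outcome_def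
    by (intro DERIV_cmult DERIV_sum deriv_expectation_RCT assms)
  then show ?thesis
    unfolding pseudo_MPE_def by (rule DERIV_imp_deriv)
qed

lemma max_bias_eq:
  assumes "0 < p" "p < 1"
  shows "max_bias n p y d = Max ((\<lambda>A. \<bar>score_mean n p A (pseudo_outcome n p y d) - score_mean n p A y\<bar>)
    ` {\<lambda>_. {1..n}, \<lambda>i. {i}, \<lambda>i. {1..n} - {i}})"
  using assms
  by (simp add: max_bias_def pseudo_MPE_eq oracle_MPE_eq pseudo_ADE_def oracle_ADE_eq
      pseudo_AIE_def oracle_AIE_eq)

section \<open>Conditional variance as mean squared residual\<close>

lemma total_cond_variance_eq:
  assumes "0 < p" "p < 1"
  shows "total_cond_variance n p y d = (\<Sum>i=1..n.
    measure_pmf.expectation (RCT n p) (\<lambda>w. (pseudo_outcome n p y d i w - y i w)\<^sup>2))"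
  unfolding total_cond_variance_def
proof (intro sum.cong refl)
  fix i
  let ?e = "\<lambda>w. (pseudo_outcome n p y d i w - y i w)\<^sup>2"
  have ne: "set_pmf (RCT n p) \<inter> {v. d i v = d i w} \<noteq> {}" if "w \<in> treatments n" for w
    using that set_RCT[OF assms] by auto
  have supp: "set_pmf (RCT_given n p (d i) (d i w)) = treatments n \<inter> {v. d i v = d i w}"
    if "w \<in> treatments n" for w
    unfolding RCT_given_def by (simp add: set_cond_pmf[OF ne[OF that]] set_RCT[OF assms])
  \<comment> \<open>Redrawing the treatments given the exposure of a first draw does not change
    their law.\<close>
  have tower: "RCT n p \<bind> (\<lambda>w. RCT_given n p (d i) (d i w)) = RCT n p"
    unfolding RCT_given_def
    by (rule bind_cond_pmf_cancel) (auto intro: arg_cong[where f = "measure_pmf.prob _"])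
  have "measure_pmf.expectation (RCT n p) ?e =
      (\<Sum>w\<in>treatments n. pmf (RCT n p) w *
        measure_pmf.expectation (RCT_given n p (d i) (d i w)) ?e)"
    using set_RCT[OF assms] supp
    by (subst tower[symmetric], subst pmf_expectation_bind[of "treatments n"]) auto
  also have "\<dots> = (\<Sum>w\<in>treatments n. pmf (RCT n p) w * cond_variance n p y d i (d i w))"
  proof (intro sum.cong refl arg_cong2[where f = "(*)"])
    \<comment> \<open>On the support of the conditional law the exposure is constant, so the
      pseudo-outcome there is the conditional mean.\<close>
    fix w assume "w \<in> treatments n"
    then show "measure_pmf.expectation (RCT_given n p (d i) (d i w)) ?e =
        cond_variance n p y d i (d i w)"
      unfolding cond_variance_def
      by (intro integral_cong_AE)
        (auto simp: AE_measure_pmf_iff supp pseudo_outcome_def hstar_def power2_commute)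
  qed
  finally show "measure_pmf.expectation (RCT n p) (\<lambda>w. cond_variance n p y d i (d i w)) =
      measure_pmf.expectation (RCT n p) ?e"
    by (simp add: expectation_RCT)
qed

section \<open>Cauchy-Schwarz estimate\<close>

lemma score_mean_diff:
  "score_mean n p A y - score_mean n p A z = score_mean n p A (\<lambda>i w. y i w - z i w)"
  by (simp add: score_mean_def left_diff_distrib sum_subtractf diff_divide_distrib)

lemma score_mean_cong:
  assumes "\<And>i w. i \<in> {1..n} \<Longrightarrow> w \<in> treatments n \<Longrightarrow> y i w = z i w"
  shows "score_mean n p A y = score_mean n p A z"
  unfolding score_mean_def
  by (intro arg_cong2[where f = "(*)"] sum.cong refl expectation_RCT_cong) (simp add: assms)

lemma score_mean_bound:
  assumes p: "0 < p" "p < 1" and n: "n \<ge> 1" and A: "\<And>i. i \<in> {1..n} \<Longrightarrow> A i \<subseteq> {1..n}"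
  shows "\<bar>score_mean n p A e\<bar> \<le>
    1 / sqrt (p * (1 - p)) * sqrt (\<Sum>i=1..n. measure_pmf.expectation (RCT n p) (\<lambda>w. (e i w)\<^sup>2))"
    (is "_ \<le> _ * sqrt ?V")
proof -
  define T where "T i w = (\<Sum>j\<in>A i. score p j w)" for i w
  define r where "r w = sqrt (pmf (RCT n p) w)" for w
  have r: "r w * r w = pmf (RCT n p) w" for w
    by (simp add: r_def)
  let ?I = "{1..n} \<times> treatments n"
  have sums: "(\<Sum>i=1..n. measure_pmf.expectation (RCT n p) (f i)) =
      (\<Sum>(i, w)\<in>?I. pmf (RCT n p) w * f i w)" for f
    by (simp add: expectation_RCT sum.cartesian_product)
  \<comment> \<open>One Cauchy-Schwarz over all pairs (i, w), with the probability weight split as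
    \<open>r w * r w\<close> between residual and score sum.\<close>
  have "(\<Sum>i=1..n. measure_pmf.expectation (RCT n p) (\<lambda>w. e i w * T i w)) =
      (\<Sum>x\<in>?I. (r (snd x) * e (fst x) (snd x)) * (r (snd x) * T (fst x) (snd x)))"
    unfolding sums by (intro sum.cong) (auto simp flip: r)
  also have "\<dots>\<^sup>2 \<le> (\<Sum>x\<in>?I. (r (snd x) * e (fst x) (snd x))\<^sup>2)
      * (\<Sum>x\<in>?I. (r (snd x) * T (fst x) (snd x))\<^sup>2)"
    by (rule Cauchy_Schwarz_ineq_sum)
  also have "(\<Sum>x\<in>?I. (r (snd x) * e (fst x) (snd x))\<^sup>2) = ?V"
    unfolding sums by (intro sum.cong) (auto simp: power2_eq_square simp flip: r)
  also have "(\<Sum>x\<in>?I. (r (snd x) * T (fst x) (snd x))\<^sup>2) =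
      (\<Sum>i=1..n. measure_pmf.expectation (RCT n p) (\<lambda>w. (T i w)\<^sup>2))"
    unfolding sums by (intro sum.cong) (auto simp: power2_eq_square simp flip: r)
  also have "\<dots> = (\<Sum>i=1..n. card (A i) / (p * (1 - p)))"
    unfolding T_def using p A by (intro sum.cong expectation_sum_scores_squared) auto
  \<comment> \<open>The second factor is thus at most n^2 / (p (1 - p)); the n^2 cancels against the
    squared prefactor 1 / n, which leaves a constant free of n.\<close>
  also have "?V * \<dots> \<le> ?V * (\<Sum>i=1..n. n / (p * (1 - p)))"
  proof (intro mult_left_mono sum_mono divide_right_mono)
    fix i assume "i \<in> {1..n}"
    then have "card (A i) \<le> n"
      using card_mono[OF _ A] by fastforce
    then show "real (card (A i)) \<le> real n"
      by simp
  qed (use p in \<open>auto intro!: sum_nonneg\<close>)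
  finally have "(real n * score_mean n p A e)\<^sup>2 \<le> ?V * (real n * n / (p * (1 - p)))"
    using n by (simp add: score_mean_def T_def)
  then have "(real n)\<^sup>2 * (score_mean n p A e)\<^sup>2 \<le> (real n)\<^sup>2 * (?V / (p * (1 - p)))"
    by (simp add: power_mult_distrib power2_eq_square mult_ac)
  then have "(score_mean n p A e)\<^sup>2 \<le> ?V / (p * (1 - p))"
    using n by (subst (asm) mult_le_cancel_left_pos) auto
  then have "\<bar>score_mean n p A e\<bar> \<le> sqrt (?V / (p * (1 - p)))"
    by (rule real_le_rsqrt[OF order_eq_refl[THEN order_trans], rotated]) simp
  then show ?thesis
    by (simp add: real_sqrt_divide)
qed

lemma bias_bound_inverse_sqrt:
  assumes "0 < p" "p < 1"
  shows "bias_bound TYPE('d) p (1 / sqrt (p * (1 - p)))"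
  unfolding bias_bound_def max_bias_eq[OF assms] total_cond_variance_eq[OF assms] score_mean_diff
proof (intro allI impI)
  fix n :: nat and y and d :: "'d exposures"
  let ?e = "\<lambda>i w. pseudo_outcome n p y d i w - y i w"
  assume n: "1 \<le> n"
  show "Max ((\<lambda>A. \<bar>score_mean n p A ?e\<bar>) ` {\<lambda>_. {1..n}, \<lambda>i. {i}, \<lambda>i. {1..n} - {i}})
    \<le> 1 / sqrt (p * (1 - p)) *
      sqrt (\<Sum>i=1..n. measure_pmf.expectation (RCT n p) (\<lambda>w. (?e i w)\<^sup>2))"
    (is "Max (?f ` ?S) \<le> ?B")
  proof (rule Max.boundedI)
    fix b assume "b \<in> ?f ` ?S"
    then obtain A where "A \<in> ?S" and b: "b = ?f A"
      by (rule imageE)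
    then have "A i \<subseteq> {1..n}" if "i \<in> {1..n}" for i
      using that by auto
    then show "b \<le> ?B"
      unfolding b by (rule score_mean_bound[OF assms n])
  qed simp_all
qed

section \<open>Transfer between exposure types\<close>

lemma cond_pmf_cong:
  assumes "set_pmf p \<inter> A = set_pmf p \<inter> B" "set_pmf p \<inter> A \<noteq> {}"
  shows "cond_pmf p A = cond_pmf p B"
proof (rule pmf_eqI)
  fix x
  have "measure_pmf.prob p A = measure_pmf.prob p B"
    using assms measure_Int_set_pmf[of p A] measure_Int_set_pmf[of p B] by (simp add: Int_commute)
  moreover have "x \<in> A \<longleftrightarrow> x \<in> B" if "pmf p x \<noteq> 0"
    using assms(1) that unfolding set_pmf_iff[symmetric] by blast
  ultimately show "pmf (cond_pmf p A) x = pmf (cond_pmf p B) x"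
    using assms by (auto simp: pmf_cond)
qed

text \<open>
  Only the finitely many exposures taken on \<^term>\<open>treatments n\<close> matter, and they can be
  encoded injectively as natural numbers.
\<close>

lemma bias_bound_nat_imp:
  assumes p: "0 < p" "p < 1" and C: "bias_bound TYPE(nat) p C"
  shows "bias_bound TYPE('d) p C"
  unfolding bias_bound_def
proof (intro allI impI)
  fix n :: nat and y and d :: "'d exposures"
  assume n: "1 \<le> n"
  \<comment> \<open>Exposures of all units are collected so that one code serves every unit.\<close>
  define R where "R = (\<Union>i\<in>{1..n}. d i ` treatments n)"
  have "finite R"
    by (simp add: R_def)
  then obtain f :: "'d \<Rightarrow> nat" where f: "inj_on f R"
    using finite_imp_inj_to_nat_seg by metis
  define d' where "d' i w = f (d i w)" for i w
  have same: "pseudo_outcome n p y d' i w = pseudo_outcome n p y d i w"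
    if "i \<in> {1..n}" "w \<in> treatments n" for i w
  proof -
    \<comment> \<open>The code is injective only on \<open>R\<close>, so level sets are compared
      only within the support, as \<open>cond_pmf_cong\<close> permits.\<close>
    have "d' i v = d' i w \<longleftrightarrow> d i v = d i w" if "v \<in> treatments n" for v
      using f \<open>i \<in> {1..n}\<close> \<open>w \<in> treatments n\<close> that by (auto simp: d'_def R_def inj_on_def)
    then have "RCT_given n p (d' i) (d' i w) = RCT_given n p (d i) (d i w)"
      unfolding RCT_given_def
      by (intro cond_pmf_cong) (use that set_RCT[OF p, of n] in auto)
    then show ?thesis
      by (simp add: pseudo_outcome_def hstar_def)
  qed
  \<comment> \<open>In the rewritten forms, exposures enter bias and variance only through the
    pseudo-outcome.\<close>
  have "max_bias n p y d' = max_bias n p y d"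
    unfolding max_bias_eq[OF p] using score_mean_cong[OF same] by simp
  moreover have "total_cond_variance n p y d' = total_cond_variance n p y d"
    unfolding total_cond_variance_eq[OF p]
    by (intro sum.cong refl expectation_RCT_cong) (simp add: same)
  ultimately show "max_bias n p y d \<le> C * sqrt (total_cond_variance n p y d)"
    using C n unfolding bias_bound_def by metis
qed

theorem corollary2p5:
  fixes \<pi> :: real
  assumes "0 < \<pi>" and "\<pi> < 1"
  shows "(\<exists>C>0. bias_bound TYPE(nat) \<pi> C)
    \<and> (\<forall>C. bias_bound TYPE(nat) \<pi> C \<longrightarrow> bias_bound TYPE('d) \<pi> C)
    \<and> (\<forall>(N :: nat \<Rightarrow> nat) (Y :: nat \<Rightarrow> outcomes) (D :: nat \<Rightarrow> 'd exposures).
          (\<forall>k. N k \<ge> 1) \<longrightarrow> filterlim N at_top sequentially \<longrightarrow>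
          (\<lambda>k. total_cond_variance (N k) \<pi> (Y k) (D k)) \<in> o(\<lambda>_. 1) \<longrightarrow>
          (\<lambda>k. max_bias (N k) \<pi> (Y k) (D k)) \<longlonglongrightarrow> 0)"
proof (intro conjI allI impI)
  show "\<exists>C>0. bias_bound TYPE(nat) \<pi> C"
    using assms bias_bound_inverse_sqrt[OF assms] by (intro exI[of _ "1 / sqrt (\<pi> * (1 - \<pi>))"]) auto
  show "bias_bound TYPE('d) \<pi> C" if "bias_bound TYPE(nat) \<pi> C" for C
    using bias_bound_nat_imp[OF assms that] .
next
  fix N :: "nat \<Rightarrow> nat" and Y :: "nat \<Rightarrow> outcomes" and D :: "nat \<Rightarrow> 'd exposures"
  let ?V = "\<lambda>k. total_cond_variance (N k) \<pi> (Y k) (D k)"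
  assume N: "\<forall>k. N k \<ge> 1" and "?V \<in> o(\<lambda>_. 1)"
  then have "?V \<longlonglongrightarrow> 0"
    using smalloD_tendsto by fastforce
  then have "(\<lambda>k. sqrt (?V k)) \<longlonglongrightarrow> 0"
    using tendsto_real_sqrt[of ?V 0] by simp
  then have "(\<lambda>k. 1 / sqrt (\<pi> * (1 - \<pi>)) * sqrt (?V k)) \<longlonglongrightarrow> 0"
    by (rule tendsto_mult_right_zero)
  moreover have "0 \<le> max_bias (N k) \<pi> (Y k) (D k)" for k
    by (auto simp: max_bias_def)
  moreover have "max_bias (N k) \<pi> (Y k) (D k) \<le> 1 / sqrt (\<pi> * (1 - \<pi>)) * sqrt (?V k)" for k
    using bias_bound_inverse_sqrt[OF assms, where 'd = 'd] N by (auto simp: bias_bound_def)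
  ultimately show "(\<lambda>k. max_bias (N k) \<pi> (Y k) (D k)) \<longlonglongrightarrow> 0"
    using tendsto_sandwich[OF _ _ tendsto_const] by (metis (mono_tags, lifting) always_eventually)
qed

end
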